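(* Let $X$ and $Y$ be real Banach spaces and let $x_1,x_2\in X$, $y_1,y_2\in Y$. Then $x_1\otimes y_1\perp_{BJ}x_2\otimes y_2$ in the injective tensor product $X\otimes^{\lambda}Y$ if and only if either $x_1\perp_{BJ}x_2$ or $y_1\perp_{BJ}y_2$.
   Context: For a real normed space $Z$ and $u,v\in Z$, $u$ is Birkhoff-James orthogonal to $v$, written $u\perp_{BJ}v$, if $\|u+\mu v\|\ge\|u\|$ for all $\mu\in\mathbb{R}$. The injective tensor product $X\otimes^{\lambda}Y$ is the completion of the algebraic tensor product $X\otimes Y$ with respect to the norm $$\Big\|\sum_{i=1}^n x_i\otimes y_i\Big\|_\lambda=\sup\Big\{\Big|\sum_{i=1}^n f(x_i)g(y_i)\Big| : f\in B_{X^*},\ g\in B_{Y^*}\Big\},$$ where $B_{X^*}$, $B_{Y^*}$ are the closed unit balls of the dual spaces. "Either ... or" is inclusive. *)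

theory Defs
  imports "HOL-Analysis.Analysis" "HOL-Library.Poly_Mapping"
begin

section \<open>Birkhoff-James orthogonality\<close>

definition birkhoff_james :: "'a::real_normed_vector \<Rightarrow> 'a \<Rightarrow> bool"  (infix "\<bottom>\<^sub>B\<^sub>J" 50)
  where "u \<bottom>\<^sub>B\<^sub>J v \<longleftrightarrow> (\<forall>\<mu>::real. norm (u + \<mu> *\<^sub>R v) \<ge> norm u)"


section \<open>Enough bounded functionals on a real normed space\<close>

text \<open>The Hahn-Banach theorem is needed to see that the injective norm is definite. The proof
  takes a minimal sublinear functional below a given one; such a functional is linear.\<close>

definition sublinear :: "('a::real_vector \<Rightarrow> real) \<Rightarrow> bool"
  where "sublinear p \<longleftrightarrow> (\<forall>x y. p (x + y) \<le> p x + p y) \<and> (\<forall>c x. c \<ge> 0 \<longrightarrow> p (c *\<^sub>R x) = c * p x)"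

lemma sublinearD:
  assumes "sublinear p"
  shows "p (x + y) \<le> p x + p y" "c \<ge> 0 \<Longrightarrow> p (c *\<^sub>R x) = c * p x" "p 0 = 0" "- p (- x) \<le> p x"
proof -
  show a: "p (x + y) \<le> p x + p y" for x y using assms by (auto simp: sublinear_def)
  show m: "c \<ge> 0 \<Longrightarrow> p (c *\<^sub>R x) = c * p x" for c x using assms by (auto simp: sublinear_def)
  show z: "p 0 = 0" using m[of 0 0] by simp
  show "- p (- x) \<le> p x" using a[of x "- x"] z by simp
qed

definition sub_shift :: "('a::real_vector \<Rightarrow> real) \<Rightarrow> 'a \<Rightarrow> 'a \<Rightarrow> real"
  where "sub_shift p y x = (INF t\<in>{0..}. p (x + t *\<^sub>R y) - t * p y)"

lemma sub_shift:
  assumes p: "sublinear p"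
  shows "sublinear (sub_shift p y)" "sub_shift p y x \<le> p x" "t \<ge> 0 \<Longrightarrow> sub_shift p y x \<le> p (x + t *\<^sub>R y) - t * p y"
proof -
  note pD = sublinearD[OF p]
  have lb: "- p (- x) \<le> p (x + t *\<^sub>R y) - t * p y" if "t \<ge> 0" for x t
    using pD(1)[of "x + t *\<^sub>R y" "- x"] pD(2)[OF that, of y] by simp
  have bdd: "bdd_below ((\<lambda>t. p (x + t *\<^sub>R y) - t * p y) ` {0..})" for x
    using lb by (auto intro!: bdd_belowI[of _ "- p (- x)"])
  have le: "sub_shift p y x \<le> p (x + t *\<^sub>R y) - t * p y" if "t \<ge> 0" for x t
    unfolding sub_shift_def by (rule cINF_lower[OF bdd]) (use that in auto)
  have ge: "a \<le> sub_shift p y x" if "\<And>t. t \<ge> 0 \<Longrightarrow> a \<le> p (x + t *\<^sub>R y) - t * p y" for a x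
    unfolding sub_shift_def by (rule cINF_greatest) (use that in auto)
  show "sub_shift p y x \<le> p (x + t *\<^sub>R y) - t * p y" if "t \<ge> 0" using le[OF that] .
  show px: "sub_shift p y x \<le> p x" for x using le[of 0 x] by simp
  show "sublinear (sub_shift p y)"
    unfolding sublinear_def
  proof (intro conjI allI impI)
    fix x z
    have "sub_shift p y (x + z) - (p (z + s *\<^sub>R y) - s * p y) \<le> sub_shift p y x" if s: "s \<ge> 0" for s
    proof (rule ge)
      fix t :: real assume t: "t \<ge> 0"
      have "sub_shift p y (x + z) \<le> p (x + z + (t + s) *\<^sub>R y) - (t + s) * p y"
        using s t by (intro le) auto
      also have "x + z + (t + s) *\<^sub>R y = (x + t *\<^sub>R y) + (z + s *\<^sub>R y)"
        by (simp add: algebra_simps)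
      also have "p \<dots> \<le> p (x + t *\<^sub>R y) + p (z + s *\<^sub>R y)" by (rule pD(1))
      finally show "sub_shift p y (x + z) - (p (z + s *\<^sub>R y) - s * p y) \<le> p (x + t *\<^sub>R y) - t * p y"
        by (simp add: algebra_simps)
    qed
    then have "sub_shift p y (x + z) - sub_shift p y x \<le> sub_shift p y z"
      by (intro ge) (simp add: algebra_simps)
    then show "sub_shift p y (x + z) \<le> sub_shift p y x + sub_shift p y z" by simp
  next
    fix c :: real and x :: 'a assume "c \<ge> 0"
    have le1: "sub_shift p y (c *\<^sub>R x) \<le> c * sub_shift p y x" if c: "c > 0" for c x
    proof -
      have "sub_shift p y (c *\<^sub>R x) / c \<le> sub_shift p y x"
      proof (rule ge)
        fix t :: real assume t: "t \<ge> 0"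
        have "sub_shift p y (c *\<^sub>R x) \<le> p (c *\<^sub>R x + (c * t) *\<^sub>R y) - (c * t) * p y"
          using c t by (intro le) auto
        also have "c *\<^sub>R x + (c * t) *\<^sub>R y = c *\<^sub>R (x + t *\<^sub>R y)" by (simp add: algebra_simps)
        also have "p \<dots> = c * p (x + t *\<^sub>R y)" using c by (intro pD(2)) auto
        finally show "sub_shift p y (c *\<^sub>R x) / c \<le> p (x + t *\<^sub>R y) - t * p y"
          using c by (simp add: field_simps)
      qed
      then show ?thesis using c by (simp add: field_simps)
    qed
    show "sub_shift p y (c *\<^sub>R x) = c * sub_shift p y x"
    proof (cases "c = 0")
      case True
      have "0 \<le> sub_shift p y 0" by (rule ge) (simp add: pD(2))
      then show ?thesis using True px[of 0] pD(3) by simp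
    next
      case False
      then have c: "c > 0" using \<open>c \<ge> 0\<close> by simp
      have "sub_shift p y x \<le> inverse c * sub_shift p y (c *\<^sub>R x)"
        using le1[of "inverse c" "c *\<^sub>R x"] c by simp
      then have "c * sub_shift p y x \<le> sub_shift p y (c *\<^sub>R x)" using c by (simp add: field_simps)
      then show ?thesis using le1[OF c, of x] by simp
    qed
  qed
qed

lemma linear_below_sublinear:
  fixes p :: "'a::real_vector \<Rightarrow> real"
  assumes p: "sublinear p"
  shows "\<exists>f. linear f \<and> (\<forall>x. f x \<le> p x)"
proof -
  define A where "A = {q. sublinear q \<and> q \<le> p}"
  define P where "P = (\<lambda>q r :: 'a \<Rightarrow> real. r \<le> q)"
  have "\<exists>m\<in>A. \<forall>a\<in>A. P m a \<longrightarrow> a = m"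
  proof (rule predicate_Zorn)
    show "partial_order_on A (relation_of P A)"
      by (auto simp: partial_order_on_def preorder_on_def refl_on_def trans_def antisym_def
          relation_of_def P_def intro: order_trans)
  next
    fix C assume C: "C \<in> Chains (relation_of P A)"
    then have CA: "q \<in> A" if "q \<in> C" for q
      using that by (auto simp: Chains_def relation_of_def)
    have tot: "q \<le> r \<or> r \<le> q" if "q \<in> C" "r \<in> C" for q r
      using C that by (auto simp: Chains_def relation_of_def P_def)
    show "\<exists>u\<in>A. \<forall>a\<in>C. P a u"
    proof (cases "C = {}")
      case True
      then show ?thesis using p by (auto simp: A_def)
    next
      case False
      define u where "u = (\<lambda>x. INF q\<in>C. q x)"
      have lb: "- p (- x) \<le> q x" if "q \<in> C" for q x
      proof -
        have "sublinear q" "q (- x) \<le> p (- x)" using CA[OF that] by (auto simp: A_def le_fun_def)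
        then show ?thesis using sublinearD(4)[of q x] by linarith
      qed
      have bdd: "bdd_below ((\<lambda>q. q x) ` C)" for x
        using lb by (auto intro!: bdd_belowI[of _ "- p (- x)"])
      have le: "u x \<le> q x" if "q \<in> C" for q x
        unfolding u_def by (rule cINF_lower[OF bdd that])
      have ge: "a \<le> u x" if "\<And>q. q \<in> C \<Longrightarrow> a \<le> q x" for a x
        unfolding u_def by (rule cINF_greatest[OF False]) (use that in auto)
      have "sublinear u" unfolding sublinear_def
      proof (intro conjI allI impI)
        fix x y
        have "u (x + y) - r y \<le> u x" if r: "r \<in> C" for r
        proof (rule ge)
          fix q assume q: "q \<in> C"
          show "u (x + y) - r y \<le> q x"
          proof (cases "q \<le> r")
            case True
            have "u (x + y) \<le> q x + q y"
              using le[OF q, of "x + y"] sublinearD(1)[of q x y] CA[OF q] by (auto simp: A_def)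
            then show ?thesis using True by (smt (verit) le_funD)
          next
            case False
            then have "r \<le> q" using tot q r by blast
            have "u (x + y) \<le> r x + r y"
              using le[OF r, of "x + y"] sublinearD(1)[of r x y] CA[OF r] by (auto simp: A_def)
            then show ?thesis using \<open>r \<le> q\<close> by (smt (verit) le_funD)
          qed
        qed
        then have "u (x + y) - u x \<le> u y" by (intro ge) (simp add: algebra_simps)
        then show "u (x + y) \<le> u x + u y" by simp
      next
        fix c :: real and x :: 'a assume c: "c \<ge> 0"
        have hom: "q (c *\<^sub>R x) = c * q x" if "q \<in> C" for q
          using CA[OF that] c sublinearD(2) by (auto simp: A_def)
        show "u (c *\<^sub>R x) = c * u x"
        proof (cases "c = 0")
          case True
          have "q 0 = 0" if "q \<in> C" for q using CA[OF that] sublinearD(3) by (auto simp: A_def)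
          then have "(\<lambda>q. q 0) ` C = {0}" using False by (auto simp: image_def)
          then have "u 0 = 0" unfolding u_def by simp
          then show ?thesis using True by simp
        next
          case ne: False
          then have c0: "c > 0" using c by simp
          have "u (c *\<^sub>R x) / c \<le> u x"
          proof (rule ge)
            fix q assume "q \<in> C"
            then show "u (c *\<^sub>R x) / c \<le> q x" using le[of q "c *\<^sub>R x"] hom[of q] c0
              by (simp add: field_simps)
          qed
          moreover have "c * u x \<le> u (c *\<^sub>R x)"
            by (rule ge) (simp add: hom mult_left_mono[OF le c])
          ultimately show ?thesis using c0 by (simp add: field_simps)
        qed
      qed
      moreover have "u \<le> p"
      proof -
        obtain q where q: "q \<in> C" using False by auto
        then have "q \<le> p" using CA by (auto simp: A_def)
        then show ?thesis using le[OF q] by (meson le_funD le_funI order_trans)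
      qed
      ultimately show ?thesis using le by (auto simp: A_def P_def le_fun_def)
    qed
  qed
  then obtain m where mA: "m \<in> A" and min: "\<And>a. a \<in> A \<Longrightarrow> a \<le> m \<Longrightarrow> a = m"
    by (auto simp: P_def)
  have m: "sublinear m" and mp: "m \<le> p" using mA by (auto simp: A_def)
  have eq: "sub_shift m y = m" for y
  proof (rule min)
    show *: "sub_shift m y \<le> m" using sub_shift(2)[OF m] by (simp add: le_fun_def)
    show "sub_shift m y \<in> A" using sub_shift(1)[OF m] order_trans[OF * mp] by (simp add: A_def)
  qed
  have add: "m (x + y) = m x + m y" for x y
    using sub_shift(3)[OF m, of 1 y x] eq[of y] sublinearD(1)[OF m, of x y] by simp
  have neg: "m (- x) = - m x" for x using add[of x "- x"] sublinearD(3)[OF m] by simp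
  have "m (c *\<^sub>R x) = c * m x" for c x
  proof (cases "c \<ge> 0")
    case True then show ?thesis using sublinearD(2)[OF m] by simp
  next
    case False
    then have "m ((- c) *\<^sub>R x) = (- c) * m x" using sublinearD(2)[OF m, of "- c" x] by simp
    then show ?thesis using neg[of "c *\<^sub>R x"] by simp
  qed
  then have "linear m" using add by (intro linearI) auto
  then show ?thesis using mp by (auto simp: le_fun_def)
qed

lemma norming_functional:
  fixes x :: "'a::real_normed_vector"
  shows "\<exists>f::'a \<Rightarrow>\<^sub>L real. norm f \<le> 1 \<and> blinfun_apply f x = norm x"
proof -
  have n: "sublinear (norm :: 'a \<Rightarrow> real)" by (auto simp: sublinear_def norm_triangle_ineq)
  obtain f where lin: "linear f" and f: "\<And>z. f z \<le> sub_shift norm x z"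
    using linear_below_sublinear[OF sub_shift(1)[OF n, of x]] by auto
  have le: "f z \<le> norm z" for z using f[of z] sub_shift(2)[OF n, of x z] by simp
  have abs: "\<bar>f z\<bar> \<le> norm z" for z using le[of z] le[of "- z"] linear_neg[OF lin, of z] by auto
  have "f (- x) \<le> - norm x" using f[of "- x"] sub_shift(3)[OF n, of 1 x "- x"] by simp
  then have fx: "f x = norm x" using le[of x] linear_neg[OF lin, of x] by simp
  have bl: "bounded_linear f"
    by (rule bounded_linear_intro[where K = 1]) (use lin abs in \<open>auto simp: linear_add linear_cmul\<close>)
  have "norm (Blinfun f) \<le> 1"
    by (rule norm_blinfun_bound) (use abs in \<open>auto simp: bounded_linear_Blinfun_apply[OF bl]\<close>)
  then show ?thesis using fx by (intro exI[of _ "Blinfun f"]) (simp add: bounded_linear_Blinfun_apply[OF bl])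
qed

lemma blinfun_separates_zero:
  fixes x :: "'a::real_normed_vector"
  assumes "\<And>f::'a \<Rightarrow>\<^sub>L real. blinfun_apply f x = 0"
  shows "x = 0"
  using norming_functional[of x] assms by auto


section \<open>The algebraic tensor product\<close>

text \<open>\<^typ>\<open>'k \<Rightarrow>\<^sub>0 real\<close> is the free real vector space on \<^typ>\<open>'k\<close>.\<close>

instantiation poly_mapping :: (type, real_vector) real_vector
begin

lift_definition scaleR_poly_mapping :: "real \<Rightarrow> ('a \<Rightarrow>\<^sub>0 'b) \<Rightarrow> 'a \<Rightarrow>\<^sub>0 'b"
  is "\<lambda>c p k. c *\<^sub>R p k"
  by (rule finite_subset[rotated]) auto

instance
  by standard (transfer; simp add: scaleR_add_right scaleR_add_left fun_eq_iff)+

end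

lemma lookup_scaleR: "Poly_Mapping.lookup (c *\<^sub>R p) k = c *\<^sub>R Poly_Mapping.lookup p k"
  by transfer simp

definition free_extend :: "('k \<Rightarrow> 'v::real_vector) \<Rightarrow> ('k \<Rightarrow>\<^sub>0 real) \<Rightarrow> 'v"
  where "free_extend \<phi> p = (\<Sum>k\<in>Poly_Mapping.keys p. Poly_Mapping.lookup p k *\<^sub>R \<phi> k)"

lemma free_extend_superset:
  assumes "finite A" "Poly_Mapping.keys p \<subseteq> A"
  shows "free_extend \<phi> p = (\<Sum>k\<in>A. Poly_Mapping.lookup p k *\<^sub>R \<phi> k)"
  unfolding free_extend_def by (rule sum.mono_neutral_left) (use assms in \<open>auto simp: in_keys_iff\<close>)

lemma linear_free_extend: "linear (free_extend \<phi>)"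
proof (rule linearI)
  fix p q :: "'a \<Rightarrow>\<^sub>0 real" and c :: real
  let ?A = "Poly_Mapping.keys p \<union> Poly_Mapping.keys q"
  have "Poly_Mapping.keys (p + q) \<subseteq> ?A" by (rule keys_add)
  then show "free_extend \<phi> (p + q) = free_extend \<phi> p + free_extend \<phi> q"
    by (simp add: free_extend_superset[of ?A] lookup_add scaleR_add_left sum.distrib)
  have "Poly_Mapping.keys (c *\<^sub>R p) \<subseteq> Poly_Mapping.keys p" by (auto simp: in_keys_iff lookup_scaleR)
  then show "free_extend \<phi> (c *\<^sub>R p) = c *\<^sub>R free_extend \<phi> p"
    by (simp add: free_extend_superset[of "Poly_Mapping.keys p"] lookup_scaleR scaleR_sum_right)
qed

lemma free_extend_single [simp]: "free_extend \<phi> (Poly_Mapping.single k c) = c *\<^sub>R \<phi> k"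
  by (cases "c = 0") (auto simp: free_extend_def)

lemma free_extend_comp:
  assumes "linear h" shows "h (free_extend \<phi> p) = free_extend (\<lambda>k. h (\<phi> k)) p"
  by (simp add: free_extend_def linear_sum[OF assms] linear_cmul[OF assms])

lemma free_extend_id: "free_extend (\<lambda>k. Poly_Mapping.single k 1) p = p"
proof (rule poly_mapping_eqI)
  fix k
  have "(if k \<in> Poly_Mapping.keys p then Poly_Mapping.lookup p k else 0) = Poly_Mapping.lookup p k" by (simp add: in_keys_iff)
  then show "Poly_Mapping.lookup (free_extend (\<lambda>k. Poly_Mapping.single k 1) p) k = Poly_Mapping.lookup p k"
    by (simp add: free_extend_def lookup_sum lookup_scaleR lookup_single when_def if_distrib cong: if_cong)
qed

inductive_set tensor_relators :: "('a::real_vector \<times> 'b::real_vector \<Rightarrow>\<^sub>0 real) set"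
where
  add_left: "Poly_Mapping.single (x + x', y) 1 - (Poly_Mapping.single (x, y) 1 + Poly_Mapping.single (x', y) 1) \<in> tensor_relators"
| add_right: "Poly_Mapping.single (x, y + y') 1 - (Poly_Mapping.single (x, y) 1 + Poly_Mapping.single (x, y') 1) \<in> tensor_relators"
| scale_left: "Poly_Mapping.single (c *\<^sub>R x, y) 1 - c *\<^sub>R Poly_Mapping.single (x, y) 1 \<in> tensor_relators"
| scale_right: "Poly_Mapping.single (x, c *\<^sub>R y) 1 - c *\<^sub>R Poly_Mapping.single (x, y) 1 \<in> tensor_relators"

definition tensor_rel :: "('a::real_vector \<times> 'b::real_vector \<Rightarrow>\<^sub>0 real) \<Rightarrow> ('a \<times> 'b \<Rightarrow>\<^sub>0 real) \<Rightarrow> bool"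
  where "tensor_rel p q \<longleftrightarrow> p - q \<in> span tensor_relators"

lemma equivp_tensor_rel: "equivp (tensor_rel :: ('a::real_vector \<times> 'b::real_vector \<Rightarrow>\<^sub>0 real) \<Rightarrow> _)" (is "equivp ?R")
proof (rule equivpI)
  show "reflp ?R" by (auto simp: reflp_def tensor_rel_def span_zero)
  show "symp ?R"
  proof (rule sympI)
    fix p q :: "'a \<times> 'b \<Rightarrow>\<^sub>0 real" assume "tensor_rel p q"
    then have "- (p - q) \<in> span tensor_relators" unfolding tensor_rel_def by (rule span_neg)
    then show "tensor_rel q p" by (simp add: tensor_rel_def)
  qed
  show "transp ?R"
  proof (rule transpI)
    fix p q r :: "'a \<times> 'b \<Rightarrow>\<^sub>0 real" assume "tensor_rel p q" "tensor_rel q r"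
    then have "(p - q) + (q - r) \<in> span tensor_relators" unfolding tensor_rel_def by (rule span_add)
    then show "tensor_rel p r" by (simp add: tensor_rel_def)
  qed
qed

quotient_type (overloaded) ('a, 'b) tensor = "'a::real_vector \<times> 'b::real_vector \<Rightarrow>\<^sub>0 real" / tensor_rel
  by (rule equivp_tensor_rel)

instantiation tensor :: (real_vector, real_vector) real_vector
begin

lift_definition zero_tensor :: "('a, 'b) tensor" is 0 .

lift_definition plus_tensor :: "('a, 'b) tensor \<Rightarrow> ('a, 'b) tensor \<Rightarrow> ('a, 'b) tensor" is "(+)"
  unfolding tensor_rel_def by (drule (1) span_add) (simp add: algebra_simps)

lift_definition minus_tensor :: "('a, 'b) tensor \<Rightarrow> ('a, 'b) tensor \<Rightarrow> ('a, 'b) tensor" is "(-)"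
  unfolding tensor_rel_def by (drule (1) span_diff) (simp add: algebra_simps)

lift_definition uminus_tensor :: "('a, 'b) tensor \<Rightarrow> ('a, 'b) tensor" is uminus
  unfolding tensor_rel_def by (drule span_neg) (simp add: algebra_simps)

lift_definition scaleR_tensor :: "real \<Rightarrow> ('a, 'b) tensor \<Rightarrow> ('a, 'b) tensor" is "(*\<^sub>R)"
  unfolding tensor_rel_def by (metis scaleR_diff_right span_scale)

instance
  by standard
    (transfer; simp add: tensor_rel_def span_zero algebra_simps)+

end

lift_definition elem_tensor :: "'a::real_vector \<Rightarrow> 'b::real_vector \<Rightarrow> ('a, 'b) tensor"  (infixr "\<otimes>" 75)
  is "\<lambda>x y. Poly_Mapping.single (x, y) 1" .

lemma tensor_rel_relator: "p - q \<in> tensor_relators \<Longrightarrow> tensor_rel p q"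
  by (simp add: tensor_rel_def span_base)

lemma elem_tensor_bilinear:
  "(x + x') \<otimes> y = x \<otimes> y + x' \<otimes> y" "x \<otimes> (y + y') = x \<otimes> y + x \<otimes> y'"
  "(c *\<^sub>R x) \<otimes> y = c *\<^sub>R (x \<otimes> y)" "x \<otimes> (c *\<^sub>R y) = c *\<^sub>R (x \<otimes> y)"
  by (transfer, rule tensor_rel_relator, rule tensor_relators.intros)+

lemma linear_elem_tensor: "linear (\<lambda>x. x \<otimes> y)" "linear (\<lambda>y. x \<otimes> y)"
  by (auto intro!: linearI simp: elem_tensor_bilinear)

lemma linear_abs_tensor: "linear abs_tensor"
  by (rule linearI) (simp_all add: plus_tensor.abs_eq scaleR_tensor.abs_eq)

lemma abs_tensor_eq: "abs_tensor p = free_extend (\<lambda>k. fst k \<otimes> snd k) p"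
proof -
  have "abs_tensor p = abs_tensor (free_extend (\<lambda>k. Poly_Mapping.single k 1) p)"
    by (simp add: free_extend_id)
  also have "\<dots> = free_extend (\<lambda>k. abs_tensor (Poly_Mapping.single k 1)) p"
    by (rule free_extend_comp[OF linear_abs_tensor])
  finally show ?thesis by (simp add: elem_tensor.abs_eq)
qed


section \<open>The injective norm\<close>

text \<open>The well-defined value of \<open>\<Sum>\<^sub>i f x\<^sub>i * g y\<^sub>i\<close> on the class of \<open>\<Sum>\<^sub>i x\<^sub>i \<otimes> y\<^sub>i\<close>.\<close>

lift_definition tensor_pairing ::
    "('a::real_normed_vector \<Rightarrow>\<^sub>L real) \<Rightarrow> ('b::real_normed_vector \<Rightarrow>\<^sub>L real) \<Rightarrow> ('a, 'b) tensor \<Rightarrow> real"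
  is "\<lambda>f g. free_extend (\<lambda>(x, y). blinfun_apply f x * blinfun_apply g y)"
proof -
  fix f :: "'a \<Rightarrow>\<^sub>L real" and g :: "'b \<Rightarrow>\<^sub>L real" and p q :: "'a \<times> 'b \<Rightarrow>\<^sub>0 real"
  let ?E = "free_extend (\<lambda>(x, y). blinfun_apply f x * blinfun_apply g y)"
  assume "tensor_rel p q"
  then have "p - q \<in> span tensor_relators" by (simp add: tensor_rel_def)
  then have "?E (p - q) = 0"
  proof (rule linear_eq_0_on_span[OF linear_free_extend, rotated])
    fix r :: "'a \<times> 'b \<Rightarrow>\<^sub>0 real" assume "r \<in> tensor_relators"
    then show "?E r = 0"
      by cases (simp_all add: linear_diff[OF linear_free_extend] linear_add[OF linear_free_extend]
          linear_cmul[OF linear_free_extend] blinfun.add_right blinfun.scaleR_right distrib_left distrib_right)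
  qed
  then show "?E p = ?E q" by (simp add: linear_diff[OF linear_free_extend])
qed

lemma linear_tensor_pairing: "linear (tensor_pairing f g)"
proof (rule linearI)
  show "tensor_pairing f g (u + v) = tensor_pairing f g u + tensor_pairing f g v" for u v
    by transfer (rule linear_add[OF linear_free_extend])
  show "tensor_pairing f g (c *\<^sub>R u) = c *\<^sub>R tensor_pairing f g u" for c u
    by transfer (rule linear_cmul[OF linear_free_extend])
qed

lemma tensor_pairing_elem [simp]:
  "tensor_pairing f g (x \<otimes> y) = blinfun_apply f x * blinfun_apply g y"
  by (simp add: elem_tensor.abs_eq tensor_pairing.abs_eq)

lemma tensor_pairing_sum:
  "tensor_pairing f g (\<Sum>i\<in>I. x i \<otimes> y i) = (\<Sum>i\<in>I. blinfun_apply f (x i) * blinfun_apply g (y i))"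
  unfolding linear_sum[OF linear_tensor_pairing] tensor_pairing_elem ..

definition injective_norm :: "('a::real_normed_vector, 'b::real_normed_vector) tensor \<Rightarrow> real"
  where "injective_norm u = Sup {\<bar>tensor_pairing f g u\<bar> | f g. norm f \<le> 1 \<and> norm g \<le> 1}"

lemma injective_norm_sum:
  "injective_norm (\<Sum>i\<in>I. x i \<otimes> y i) =
    Sup {\<bar>\<Sum>i\<in>I. blinfun_apply f (x i) * blinfun_apply g (y i)\<bar> | f g. norm f \<le> 1 \<and> norm g \<le> 1}"
  by (simp add: injective_norm_def tensor_pairing_sum)

lemma tensor_pairing_bound:
  "\<exists>K. \<forall>f g. norm f \<le> 1 \<and> norm g \<le> 1 \<longrightarrow> \<bar>tensor_pairing f g u\<bar> \<le> K"
proof (transfer, intro exI allI impI)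
  fix f :: "'a \<Rightarrow>\<^sub>L real" and g :: "'b \<Rightarrow>\<^sub>L real" and p :: "'a \<times> 'b \<Rightarrow>\<^sub>0 real" assume fg: "norm f \<le> 1 \<and> norm g \<le> 1"
  have b: "\<bar>blinfun_apply f x * blinfun_apply g y\<bar> \<le> norm x * norm y" for x y
  proof -
    have f: "\<bar>blinfun_apply f x\<bar> \<le> norm x"
      using order_trans[OF norm_blinfun[of f x] mult_right_mono[of "norm f" 1 "norm x"]] fg by simp
    have g: "\<bar>blinfun_apply g y\<bar> \<le> norm y"
      using order_trans[OF norm_blinfun[of g y] mult_right_mono[of "norm g" 1 "norm y"]] fg by simp
    show ?thesis unfolding abs_mult by (rule mult_mono[OF f g]) simp_all
  qed
  have "\<bar>free_extend (\<lambda>(x, y). blinfun_apply f x * blinfun_apply g y) p\<bar>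
      \<le> (\<Sum>k\<in>Poly_Mapping.keys p. \<bar>Poly_Mapping.lookup p k *\<^sub>R (case k of (x, y) \<Rightarrow> blinfun_apply f x * blinfun_apply g y)\<bar>)"
    unfolding free_extend_def by (rule sum_abs)
  also have "\<dots> \<le> (\<Sum>k\<in>Poly_Mapping.keys p. \<bar>Poly_Mapping.lookup p k\<bar> * (norm (fst k) * norm (snd k)))"
  proof (rule sum_mono)
    fix k
    show "\<bar>Poly_Mapping.lookup p k *\<^sub>R (case k of (x, y) \<Rightarrow> blinfun_apply f x * blinfun_apply g y)\<bar>
        \<le> \<bar>Poly_Mapping.lookup p k\<bar> * (norm (fst k) * norm (snd k))"
      using mult_left_mono[OF b[of "fst k" "snd k"] abs_ge_zero[of "Poly_Mapping.lookup p k"]]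
      by (simp only: real_scaleR_def abs_mult split_def)
  qed
  finally show "\<bar>free_extend (\<lambda>(x, y). blinfun_apply f x * blinfun_apply g y) p\<bar>
      \<le> (\<Sum>k\<in>Poly_Mapping.keys p. \<bar>Poly_Mapping.lookup p k\<bar> * (norm (fst k) * norm (snd k)))" .
qed

lemma injective_norm_upper:
  assumes "norm f \<le> 1" "norm g \<le> 1" shows "\<bar>tensor_pairing f g u\<bar> \<le> injective_norm u"
proof -
  obtain K where K: "\<forall>f g. norm f \<le> 1 \<and> norm g \<le> 1 \<longrightarrow> \<bar>tensor_pairing f g u\<bar> \<le> K"
    using tensor_pairing_bound by blast
  show ?thesis unfolding injective_norm_def
  proof (rule cSup_upper)
    show "\<bar>tensor_pairing f g u\<bar> \<in> {\<bar>tensor_pairing f g u\<bar> | f g. norm f \<le> 1 \<and> norm g \<le> 1}"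
      using assms by blast
    show "bdd_above {\<bar>tensor_pairing f g u\<bar> | f g. norm f \<le> 1 \<and> norm g \<le> 1}"
      using K by (intro bdd_aboveI[of _ K]) blast
  qed
qed

lemma injective_norm_least:
  assumes "\<And>f g. norm f \<le> 1 \<Longrightarrow> norm g \<le> 1 \<Longrightarrow> \<bar>tensor_pairing f g u\<bar> \<le> K"
  shows "injective_norm u \<le> K"
proof -
  have "\<bar>tensor_pairing 0 0 u\<bar> \<in> {\<bar>tensor_pairing f g u\<bar> | f g. norm f \<le> 1 \<and> norm g \<le> 1}"
    by (rule CollectI) (rule exI[of _ 0], rule exI[of _ 0], simp)
  then show ?thesis unfolding injective_norm_def by (intro cSup_least) (use assms in blast)+
qed

lemma tensor_pairing_scale:
  "tensor_pairing (c *\<^sub>R f) (d *\<^sub>R g) u = c * d * tensor_pairing f g u"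
  by transfer (simp add: free_extend_def sum_distrib_left split_def blinfun.scaleR_left algebra_simps)

lemma tensor_eq_0:
  fixes u :: "('a::real_normed_vector, 'b::real_normed_vector) tensor"
  assumes zero: "\<And>f g. tensor_pairing f g u = 0"
  shows "u = 0"
proof -
  obtain p where p: "u = abs_tensor p" by (induction u rule: tensor.abs_induct) blast
  obtain B :: "'b set" where B: "independent B" "span B = UNIV"
    using maximal_independent_subset[of "UNIV :: 'b set"] by (metis top.extremum_unique)
  define r where "r = (\<lambda>y. representation B y)"
  define F where "F = (\<Union>k\<in>Poly_Mapping.keys p. {b. r (snd k) b \<noteq> 0})"
  have fr: "finite {b. r y b \<noteq> 0}" for y unfolding r_def by (rule finite_representation)
  have F: "finite F" unfolding F_def using fr by auto
  have FB: "F \<subseteq> B" unfolding F_def r_def using representation_ne_zero by fastforce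
  define z where "z = (\<lambda>b. \<Sum>k\<in>Poly_Mapping.keys p. (Poly_Mapping.lookup p k * r (snd k) b) *\<^sub>R fst k)"
  have y: "snd k = (\<Sum>b\<in>F. r (snd k) b *\<^sub>R b)" if "k \<in> Poly_Mapping.keys p" for k
  proof -
    have "snd k = (\<Sum>b | r (snd k) b \<noteq> 0. r (snd k) b *\<^sub>R b)"
      unfolding r_def by (rule sum_nonzero_representation_eq[symmetric]) (use B in auto)
    also have "\<dots> = (\<Sum>b\<in>F. r (snd k) b *\<^sub>R b)"
      by (rule sum.mono_neutral_left) (use F that in \<open>auto simp: F_def\<close>)
    finally show ?thesis .
  qed
  have "u = (\<Sum>k\<in>Poly_Mapping.keys p. Poly_Mapping.lookup p k *\<^sub>R (fst k \<otimes> (\<Sum>b\<in>F. r (snd k) b *\<^sub>R b)))"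
    unfolding p abs_tensor_eq free_extend_def using y by (intro sum.cong) auto
  also have "\<dots> = (\<Sum>k\<in>Poly_Mapping.keys p. \<Sum>b\<in>F. (Poly_Mapping.lookup p k * r (snd k) b) *\<^sub>R (fst k \<otimes> b))"
    by (simp add: linear_sum[OF linear_elem_tensor(2)] elem_tensor_bilinear scaleR_sum_right)
  also have "\<dots> = (\<Sum>b\<in>F. \<Sum>k\<in>Poly_Mapping.keys p. (Poly_Mapping.lookup p k * r (snd k) b) *\<^sub>R (fst k \<otimes> b))"
    by (rule sum.swap)
  also have "\<dots> = (\<Sum>b\<in>F. z b \<otimes> b)"
    by (simp add: z_def linear_sum[OF linear_elem_tensor(1)] elem_tensor_bilinear)
  finally have u: "u = (\<Sum>b\<in>F. z b \<otimes> b)" .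
  have "z b = 0" if b: "b \<in> F" for b
  proof (rule blinfun_separates_zero)
    fix f :: "'a \<Rightarrow>\<^sub>L real"
    have "(\<Sum>b\<in>F. blinfun_apply f (z b) *\<^sub>R b) = 0"
    proof (rule blinfun_separates_zero)
      fix g :: "'b \<Rightarrow>\<^sub>L real"
      show "blinfun_apply g (\<Sum>b\<in>F. blinfun_apply f (z b) *\<^sub>R b) = 0"
        using zero[of f g] unfolding u tensor_pairing_sum
        by (simp add: blinfun.sum_right blinfun.scaleR_right)
    qed
    then show "blinfun_apply f (z b) = 0" using independentD[OF B(1) F FB, of "\<lambda>b. blinfun_apply f (z b)" b] b by simp
  qed
  then show ?thesis unfolding u by (simp add: linear_0[OF linear_elem_tensor(1)])
qed

instantiation tensor :: (real_normed_vector, real_normed_vector) real_normed_vector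
begin

definition norm_tensor :: "('a, 'b) tensor \<Rightarrow> real"
  where "norm_tensor = injective_norm"

definition sgn_tensor :: "('a, 'b) tensor \<Rightarrow> ('a, 'b) tensor"
  where "sgn_tensor u = u /\<^sub>R norm u"

definition dist_tensor :: "('a, 'b) tensor \<Rightarrow> ('a, 'b) tensor \<Rightarrow> real"
  where "dist_tensor u v = norm (u - v)"

definition uniformity_tensor :: "(('a, 'b) tensor \<times> ('a, 'b) tensor) filter"
  where "uniformity_tensor = (INF e\<in>{0 <..}. principal {(u, v). dist u v < e})"

definition open_tensor :: "('a, 'b) tensor set \<Rightarrow> bool"
  where "open_tensor U \<longleftrightarrow> (\<forall>u\<in>U. eventually (\<lambda>(u', v). u' = u \<longrightarrow> v \<in> U) uniformity)"

instance
proof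
  fix u v :: "('a, 'b) tensor" and c :: real and U :: "('a, 'b) tensor set"
  show "dist u v = norm (u - v)" by (rule dist_tensor_def)
  show "sgn u = u /\<^sub>R norm u" by (rule sgn_tensor_def)
  show "uniformity = (INF e\<in>{0 <..}. principal {(u, v). dist u (v :: ('a, 'b) tensor) < e})"
    by (rule uniformity_tensor_def)
  show "open U = (\<forall>u\<in>U. \<forall>\<^sub>F (u', v) in uniformity. u' = u \<longrightarrow> v \<in> U)"
    by (rule open_tensor_def)
  have sc: "injective_norm (c *\<^sub>R u) \<le> \<bar>c\<bar> * injective_norm u" for c and u :: "('a, 'b) tensor"
    by (rule injective_norm_least)
      (simp add: linear_cmul[OF linear_tensor_pairing] abs_mult mult_left_mono injective_norm_upper)
  show "norm (c *\<^sub>R u) = \<bar>c\<bar> * norm u"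
  proof (cases "c = 0")
    case True
    have "injective_norm (0 :: ('a, 'b) tensor) \<ge> 0"
      using injective_norm_upper[of 0 0 "0 :: ('a, 'b) tensor"] by simp
    then show ?thesis using True sc[of 0 u] by (simp add: norm_tensor_def)
  next
    case False
    have "injective_norm u \<le> \<bar>inverse c\<bar> * injective_norm (c *\<^sub>R u)"
      using sc[of "inverse c" "c *\<^sub>R u"] False by simp
    then have "\<bar>c\<bar> * injective_norm u \<le> injective_norm (c *\<^sub>R u)"
      using False by (simp add: field_simps)
    then show ?thesis using sc[of c u] by (simp add: norm_tensor_def)
  qed
  then have n0: "norm (0 :: ('a, 'b) tensor) = 0"
    using sc[of 0 0] injective_norm_upper[of 0 0 "0 :: ('a, 'b) tensor"] by (simp add: norm_tensor_def)
  show "norm (u + v) \<le> norm u + norm v"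
    unfolding norm_tensor_def
  proof (rule injective_norm_least)
    fix f :: "'a \<Rightarrow>\<^sub>L real" and g :: "'b \<Rightarrow>\<^sub>L real" assume fg: "norm f \<le> 1" "norm g \<le> 1"
    show "\<bar>tensor_pairing f g (u + v)\<bar> \<le> injective_norm u + injective_norm v"
      using injective_norm_upper[OF fg, of u] injective_norm_upper[OF fg, of v]
      by (simp add: linear_add[OF linear_tensor_pairing])
  qed
  show "norm u = 0 \<longleftrightarrow> u = 0"
  proof
    assume n: "norm u = 0"
    show "u = 0"
    proof (rule tensor_eq_0)
      fix f :: "'a \<Rightarrow>\<^sub>L real" and g :: "'b \<Rightarrow>\<^sub>L real"
      show "tensor_pairing f g u = 0"
      proof (cases "f = 0 \<or> g = 0")
        case True
        then show ?thesis
          using tensor_pairing_scale[of 0 f 1 g u] tensor_pairing_scale[of 1 f 0 g u] by auto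
      next
        case False
        have "\<bar>tensor_pairing (inverse (norm f) *\<^sub>R f) (inverse (norm g) *\<^sub>R g) u\<bar> \<le> injective_norm u"
          by (rule injective_norm_upper) (use False in auto)
        then show ?thesis using n False by (simp add: norm_tensor_def tensor_pairing_scale)
      qed
    qed
  qed (simp add: n0)
qed

end


section \<open>The completion of a normed space\<close>

definition cauchy_rel :: "(nat \<Rightarrow> 'a::real_normed_vector) \<Rightarrow> (nat \<Rightarrow> 'a) \<Rightarrow> bool"
  where "cauchy_rel X Y \<longleftrightarrow> Cauchy X \<and> Cauchy Y \<and> (\<lambda>n. X n - Y n) \<longlonglongrightarrow> 0"

lemma Cauchy_const: "Cauchy (\<lambda>n. c)"
  by (intro convergent_Cauchy convergent_const)

lemma Cauchy_add':
  fixes X Y :: "nat \<Rightarrow> 'a::real_normed_vector"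
  assumes "Cauchy X" "Cauchy Y" shows "Cauchy (\<lambda>n. X n + Y n)"
proof (rule CauchyI)
  fix e :: real assume "e > 0"
  then obtain M N where M: "\<forall>m\<ge>M. \<forall>n\<ge>M. norm (X m - X n) < e / 2"
    and N: "\<forall>m\<ge>N. \<forall>n\<ge>N. norm (Y m - Y n) < e / 2"
    using CauchyD[OF assms(1), of "e / 2"] CauchyD[OF assms(2), of "e / 2"] by auto
  have "norm (X m + Y m - (X n + Y n)) < e" if "m \<ge> max M N" "n \<ge> max M N" for m n
  proof -
    have "X m + Y m - (X n + Y n) = (X m - X n) + (Y m - Y n)" by simp
    then have "norm (X m + Y m - (X n + Y n)) \<le> norm (X m - X n) + norm (Y m - Y n)"
      by (metis norm_triangle_ineq)
    moreover have "norm (X m - X n) < e / 2" "norm (Y m - Y n) < e / 2" using M N that by auto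
    ultimately show ?thesis by linarith
  qed
  then show "\<exists>M. \<forall>m\<ge>M. \<forall>n\<ge>M. norm (X m + Y m - (X n + Y n)) < e" by blast
qed

lemma Cauchy_scaleR': "Cauchy X \<Longrightarrow> Cauchy (\<lambda>n. c *\<^sub>R X n)"
  for X :: "nat \<Rightarrow> 'a::real_normed_vector"
  by (rule bounded_linear.Cauchy[OF bounded_linear_scaleR_right])

lemma Cauchy_minus': "Cauchy X \<Longrightarrow> Cauchy (\<lambda>n. - X n)" for X :: "nat \<Rightarrow> 'a::real_normed_vector"
  using Cauchy_scaleR'[of X "-1"] by simp

lemma Cauchy_diff': "Cauchy X \<Longrightarrow> Cauchy Y \<Longrightarrow> Cauchy (\<lambda>n. X n - Y n)"
  for X :: "nat \<Rightarrow> 'a::real_normed_vector"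
  using Cauchy_add'[of X "\<lambda>n. - Y n"] Cauchy_minus'[of Y] by simp

lemma Cauchy_norm_convergent:
  fixes X :: "nat \<Rightarrow> 'a::real_normed_vector"
  assumes "Cauchy X" shows "convergent (\<lambda>n. norm (X n))"
proof -
  have "Cauchy (\<lambda>n. norm (X n))"
  proof (rule CauchyI)
    fix e :: real assume "e > 0"
    then obtain M where "\<forall>m\<ge>M. \<forall>n\<ge>M. norm (X m - X n) < e" using CauchyD[OF assms] by blast
    then show "\<exists>M. \<forall>m\<ge>M. \<forall>n\<ge>M. norm (norm (X m) - norm (X n)) < e"
      by (smt (verit) norm_triangle_ineq3 real_norm_def)
  qed
  then show ?thesis by (simp add: Cauchy_convergent_iff)
qed

lemma part_equivp_cauchy_rel: "part_equivp (cauchy_rel :: (nat \<Rightarrow> 'a::real_normed_vector) \<Rightarrow> _)" (is "part_equivp ?R")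
proof (rule part_equivpI)
  show "\<exists>X. ?R X X"
    by (rule exI[of _ "\<lambda>_. 0"]) (simp add: cauchy_rel_def Cauchy_const)
  show "symp ?R"
  proof (rule sympI)
    fix X Y :: "nat \<Rightarrow> 'a" assume "cauchy_rel X Y"
    then show "cauchy_rel Y X" using tendsto_minus[of "\<lambda>n. X n - Y n" 0 sequentially]
      by (simp add: cauchy_rel_def)
  qed
  show "transp ?R"
  proof (rule transpI)
    fix X Y Z :: "nat \<Rightarrow> 'a" assume "cauchy_rel X Y" "cauchy_rel Y Z"
    then show "cauchy_rel X Z"
      using tendsto_add[of "\<lambda>n. X n - Y n" 0 sequentially "\<lambda>n. Y n - Z n" 0] by (simp add: cauchy_rel_def)
  qed
qed

quotient_type (overloaded) 'a normed_completion = "nat \<Rightarrow> 'a::real_normed_vector" / partial: cauchy_rel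
  by (rule part_equivp_cauchy_rel)

instantiation normed_completion :: (real_normed_vector) real_vector
begin

lift_definition zero_normed_completion :: "'a normed_completion" is "\<lambda>_. 0"
  by (simp add: cauchy_rel_def Cauchy_const)

lift_definition plus_normed_completion ::
    "'a normed_completion \<Rightarrow> 'a normed_completion \<Rightarrow> 'a normed_completion" is "\<lambda>X Y n. X n + Y n"
  unfolding cauchy_rel_def by (auto intro: Cauchy_add' simp: add_diff_add intro!: tendsto_add_zero)

lift_definition minus_normed_completion ::
    "'a normed_completion \<Rightarrow> 'a normed_completion \<Rightarrow> 'a normed_completion" is "\<lambda>X Y n. X n - Y n"
proof -
  fix X X' Y Y' :: "nat \<Rightarrow> 'a" assume a: "cauchy_rel X X'" "cauchy_rel Y Y'"
  then have "(\<lambda>n. (X n - X' n) - (Y n - Y' n)) \<longlonglongrightarrow> 0 - 0"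
    by (intro tendsto_diff) (auto simp: cauchy_rel_def)
  then show "cauchy_rel (\<lambda>n. X n - Y n) (\<lambda>n. X' n - Y' n)"
    using a by (auto simp: cauchy_rel_def algebra_simps intro: Cauchy_diff')
qed

lift_definition uminus_normed_completion :: "'a normed_completion \<Rightarrow> 'a normed_completion"
  is "\<lambda>X n. - X n"
proof -
  fix X Y :: "nat \<Rightarrow> 'a" assume a: "cauchy_rel X Y"
  then have "(\<lambda>n. - (X n - Y n)) \<longlonglongrightarrow> - 0" by (intro tendsto_minus) (auto simp: cauchy_rel_def)
  then show "cauchy_rel (\<lambda>n. - X n) (\<lambda>n. - Y n)"
    using a by (auto simp: cauchy_rel_def algebra_simps intro: Cauchy_minus')
qed

lift_definition scaleR_normed_completion :: "real \<Rightarrow> 'a normed_completion \<Rightarrow> 'a normed_completion"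
  is "\<lambda>c X n. c *\<^sub>R X n"
proof -
  fix c :: real and X Y :: "nat \<Rightarrow> 'a" assume a: "cauchy_rel X Y"
  then have "(\<lambda>n. c *\<^sub>R (X n - Y n)) \<longlonglongrightarrow> c *\<^sub>R 0"
    by (intro tendsto_scaleR tendsto_const) (auto simp: cauchy_rel_def)
  then show "cauchy_rel (\<lambda>n. c *\<^sub>R X n) (\<lambda>n. c *\<^sub>R Y n)"
    using a by (auto simp: cauchy_rel_def algebra_simps intro: Cauchy_scaleR')
qed

instance
  by standard
    (transfer; auto simp: cauchy_rel_def algebra_simps
       intro: Cauchy_add' Cauchy_diff' Cauchy_minus' Cauchy_scaleR' Cauchy_const)+

end

instantiation normed_completion :: (real_normed_vector) real_normed_vector
begin

lift_definition norm_normed_completion :: "'a normed_completion \<Rightarrow> real" is "\<lambda>X. lim (\<lambda>n. norm (X n))"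
proof -
  fix X Y :: "nat \<Rightarrow> 'a" assume a: "cauchy_rel X Y"
  then have X: "(\<lambda>n. norm (X n)) \<longlonglongrightarrow> lim (\<lambda>n. norm (X n))"
    using Cauchy_norm_convergent by (auto simp: cauchy_rel_def convergent_LIMSEQ_iff)
  have "(\<lambda>n. norm (X n - Y n)) \<longlonglongrightarrow> 0" using a by (auto simp: cauchy_rel_def tendsto_norm_zero_iff)
  then have "(\<lambda>n. norm (Y n) - norm (X n)) \<longlonglongrightarrow> 0"
    by (rule Lim_null_comparison[rotated]) (auto simp: norm_minus_commute[of "X _"] norm_triangle_ineq3)
  from tendsto_add[OF this X] have "(\<lambda>n. norm (Y n)) \<longlonglongrightarrow> lim (\<lambda>n. norm (X n))" by simp
  then show "lim (\<lambda>n. norm (X n)) = lim (\<lambda>n. norm (Y n))" by (simp add: limI)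
qed

definition sgn_normed_completion :: "'a normed_completion \<Rightarrow> 'a normed_completion"
  where "sgn_normed_completion u = u /\<^sub>R norm u"

definition dist_normed_completion :: "'a normed_completion \<Rightarrow> 'a normed_completion \<Rightarrow> real"
  where "dist_normed_completion u v = norm (u - v)"

definition uniformity_normed_completion :: "('a normed_completion \<times> 'a normed_completion) filter"
  where "uniformity_normed_completion = (INF e\<in>{0 <..}. principal {(u, v). dist u v < e})"

definition open_normed_completion :: "'a normed_completion set \<Rightarrow> bool"
  where "open_normed_completion U \<longleftrightarrow> (\<forall>u\<in>U. eventually (\<lambda>(u', v). u' = u \<longrightarrow> v \<in> U) uniformity)"

instance
proof
  fix u v :: "'a normed_completion" and c :: real and U :: "'a normed_completion set"
  show "dist u v = norm (u - v)" by (rule dist_normed_completion_def)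
  show "sgn u = u /\<^sub>R norm u" by (rule sgn_normed_completion_def)
  show "uniformity = (INF e\<in>{0 <..}. principal {(u, v). dist u (v :: 'a normed_completion) < e})"
    by (rule uniformity_normed_completion_def)
  show "open U = (\<forall>u\<in>U. \<forall>\<^sub>F (u', v) in uniformity. u' = u \<longrightarrow> v \<in> U)"
    by (rule open_normed_completion_def)
  have lim: "(\<lambda>n. norm (X n)) \<longlonglongrightarrow> lim (\<lambda>n. norm (X n))" if "Cauchy X" for X :: "nat \<Rightarrow> 'a"
    using Cauchy_norm_convergent[OF that] by (simp add: convergent_LIMSEQ_iff)
  show "norm u = 0 \<longleftrightarrow> u = 0"
  proof transfer
    fix X :: "nat \<Rightarrow> 'a" assume "cauchy_rel X X"
    then have X: "Cauchy X" by (simp add: cauchy_rel_def)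
    have "lim (\<lambda>n. norm (X n)) = 0 \<longleftrightarrow> (\<lambda>n. norm (X n)) \<longlonglongrightarrow> 0"
      using lim[OF X] by (metis limI)
    then show "lim (\<lambda>n. norm (X n)) = 0 \<longleftrightarrow> cauchy_rel X (\<lambda>_. 0)"
      using X by (simp add: cauchy_rel_def Cauchy_const tendsto_norm_zero_iff)
  qed
  show "norm (u + v) \<le> norm u + norm v"
  proof transfer
    fix X Y :: "nat \<Rightarrow> 'a" assume "cauchy_rel X X" "cauchy_rel Y Y"
    then have "Cauchy X" "Cauchy Y" by (auto simp: cauchy_rel_def)
    then show "lim (\<lambda>n. norm (X n + Y n)) \<le> lim (\<lambda>n. norm (X n)) + lim (\<lambda>n. norm (Y n))"
      by (intro LIMSEQ_le[OF lim[OF Cauchy_add'] tendsto_add[OF lim lim]]) (auto simp: norm_triangle_ineq)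
  qed
  show "norm (c *\<^sub>R u) = \<bar>c\<bar> * norm u"
  proof transfer
    fix c :: real and X :: "nat \<Rightarrow> 'a" assume "cauchy_rel X X"
    then have "Cauchy X" by (auto simp: cauchy_rel_def)
    from tendsto_mult_left[OF lim[OF this], of "\<bar>c\<bar>"]
    show "lim (\<lambda>n. norm (c *\<^sub>R X n)) = \<bar>c\<bar> * lim (\<lambda>n. norm (X n))" by (simp add: limI)
  qed
qed

end

lift_definition to_completion :: "'a::real_normed_vector \<Rightarrow> 'a normed_completion" is "\<lambda>x n. x"
  by (simp add: cauchy_rel_def Cauchy_const)

lemma linear_to_completion: "linear to_completion"
proof (rule linearI)
  show "to_completion (x + y) = to_completion x + to_completion y" for x y :: 'a
    by transfer (simp add: cauchy_rel_def Cauchy_const)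
  show "to_completion (c *\<^sub>R x) = c *\<^sub>R to_completion x" for c and x :: 'a
    by transfer (simp add: cauchy_rel_def Cauchy_const)
qed

lemma norm_to_completion [simp]: "norm (to_completion x) = norm x"
  by transfer (simp add: limI)

lemma to_completion_approx:
  assumes "e > 0" shows "\<exists>x. norm (u - to_completion x) < e"
  using assms
proof transfer
  fix e :: real and X :: "nat \<Rightarrow> 'a" assume e: "e > 0" and "cauchy_rel X X"
  then have X: "Cauchy X" by (simp add: cauchy_rel_def)
  then obtain M where M: "\<forall>m\<ge>M. \<forall>n\<ge>M. norm (X m - X n) < e / 2"
    using CauchyD[of X "e / 2"] e by auto
  have "convergent (\<lambda>n. norm (X n - X M))"
    by (intro Cauchy_norm_convergent Cauchy_diff' X Cauchy_const)
  then have "lim (\<lambda>n. norm (X n - X M)) \<le> e / 2"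
    using M by (intro LIMSEQ_le_const2[of "\<lambda>n. norm (X n - X M)"])
      (auto simp: convergent_LIMSEQ_iff intro!: exI[of _ M] less_imp_le)
  then show "\<exists>x. lim (\<lambda>n. norm (X n - x)) < e" using e by (intro exI[of _ "X M"]) simp
qed

lemma closure_range_to_completion: "closure (range to_completion) = UNIV"
proof -
  have "u \<in> closure (range to_completion)" for u :: "'a normed_completion"
    using to_completion_approx[of _ u] by (auto simp: closure_approachable dist_norm norm_minus_commute)
  then show ?thesis by auto
qed

instance normed_completion :: (real_normed_vector) banach
proof
  fix U :: "nat \<Rightarrow> 'a normed_completion" assume U: "Cauchy U"
  have "\<forall>n. \<exists>x. norm (U n - to_completion x) < inverse (real (Suc n))"
    by (intro allI to_completion_approx) simp
  then obtain X where X: "\<And>n. norm (U n - to_completion (X n)) < inverse (real (Suc n))" by metis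
  have UX0: "(\<lambda>n. U n - to_completion (X n)) \<longlonglongrightarrow> 0"
    by (rule Lim_null_comparison[OF _ LIMSEQ_inverse_real_of_nat]) (use X in \<open>auto intro!: always_eventually less_imp_le simp del: of_nat_Suc\<close>)
  have "Cauchy (\<lambda>n. U n - (U n - to_completion (X n)))"
    by (intro Cauchy_diff' U convergent_Cauchy convergentI[OF UX0])
  then have CX': "Cauchy (\<lambda>n. to_completion (X n))" by simp
  have "norm (to_completion x - to_completion y) = norm (x - y)" for x y :: 'a
    by (metis linear_diff[OF linear_to_completion] norm_to_completion)
  then have CX: "Cauchy X" using CX' by (simp add: Cauchy_iff)
  define L where "L = abs_normed_completion X"
  have LX: "cauchy_rel X X" using CX by (simp add: cauchy_rel_def)
  have dist_L: "norm (to_completion y - L) = lim (\<lambda>n. norm (y - X n))" for y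
  proof -
    have "to_completion y - L = abs_normed_completion (\<lambda>n. y - X n)"
      unfolding L_def to_completion.abs_eq
      by (rule minus_normed_completion.abs_eq) (use LX in \<open>auto simp: cauchy_rel_def Cauchy_const\<close>)
    moreover have "cauchy_rel (\<lambda>n. y - X n) (\<lambda>n. y - X n)"
      by (auto simp: cauchy_rel_def intro: Cauchy_diff' Cauchy_const CX)
    ultimately show ?thesis by (simp add: norm_normed_completion.abs_eq)
  qed
  have "(\<lambda>n. to_completion (X n)) \<longlonglongrightarrow> L"
  proof (rule LIMSEQ_I)
    fix e :: real assume e: "e > 0"
    then obtain M where M: "\<forall>m\<ge>M. \<forall>n\<ge>M. norm (X m - X n) < e / 2"
      using CauchyD[OF CX, of "e / 2"] by auto
    have "norm (to_completion (X m) - L) < e" if "m \<ge> M" for m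
    proof -
      have "convergent (\<lambda>n. norm (X m - X n))"
        by (intro Cauchy_norm_convergent Cauchy_diff' CX Cauchy_const)
      then have "lim (\<lambda>n. norm (X m - X n)) \<le> e / 2"
        using M that by (intro LIMSEQ_le_const2[of "\<lambda>n. norm (X m - X n)"])
          (auto simp: convergent_LIMSEQ_iff intro!: exI[of _ M] less_imp_le)
      then show ?thesis using e by (simp add: dist_L)
    qed
    then show "\<exists>M. \<forall>m\<ge>M. norm (to_completion (X m) - L) < e" by blast
  qed
  from tendsto_add[OF UX0 this] have "U \<longlonglongrightarrow> L" by simp
  then show "convergent U" by (rule convergentI)
qed


section \<open>The injective tensor product\<close>

text \<open>The type constructor \<open>tensor\<close> carries the injective norm as its norm, so this is the
  completion of the algebraic tensor product in that norm.\<close>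

type_synonym ('a, 'b) injective_tensor_product = "('a, 'b) tensor normed_completion"

end

theory Submission
  imports Defs
begin

text \<open>If \<open>x\<^sub>1\<close> is orthogonal to \<open>x\<^sub>2\<close>, James' characterisation gives a functional \<open>f\<close> that norms \<open>x\<^sub>1\<close>
  and vanishes at \<open>x\<^sub>2\<close>; together with a norming functional \<open>g\<close> of \<open>y\<^sub>1\<close> it shows
  \<open>\<parallel>x\<^sub>1 \<otimes> y\<^sub>1 + \<mu> (x\<^sub>2 \<otimes> y\<^sub>2)\<parallel> \<ge> \<parallel>x\<^sub>1\<parallel> \<parallel>y\<^sub>1\<parallel>\<close>. Conversely, if \<open>p = x\<^sub>1 + \<mu> x\<^sub>2\<close> and
  \<open>q = y\<^sub>1 + \<nu> y\<^sub>2\<close> are strictly shorter than \<open>x\<^sub>1\<close> and \<open>y\<^sub>1\<close>, then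
  \<open>x\<^sub>1 \<otimes> y\<^sub>1 - (\<mu> \<nu> / 2) (x\<^sub>2 \<otimes> y\<^sub>2) = x\<^sub>1 \<otimes> y\<^sub>1 - (x\<^sub>1 - p) \<otimes> (y\<^sub>1 - q) / 2\<close> has norm at most
  \<open>\<parallel>x\<^sub>1\<parallel> \<parallel>y\<^sub>1\<parallel> - (\<parallel>x\<^sub>1\<parallel> - \<parallel>p\<parallel>) (\<parallel>y\<^sub>1\<parallel> - \<parallel>q\<parallel>) / 2\<close>.\<close>

text \<open>Any linear functional below \<open>sub_shift q z\<close> works: it stays below
  \<open>q\<close>, and the choice \<open>t = 1\<close> bounds its value at \<open>- z\<close> by
  \<open>- q z\<close>.\<close>

lemma linear_below_sublinear_attaining:
  assumes q: "sublinear q"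
  obtains f where "linear f" "\<And>v. f v \<le> q v" "f z = q z"
proof -
  obtain f where lin: "linear f" and f: "\<And>v. f v \<le> sub_shift q z v"
    using linear_below_sublinear[OF sub_shift(1)[OF q, of z]] by auto
  have le: "f v \<le> q v" for v using f[of v] sub_shift(2)[OF q, of z v] by simp
  have "f (- z) \<le> - q z" using f[of "- z"] sub_shift(3)[OF q, of 1 z "- z"] sublinearD(3)[OF q] by simp
  then have "f z = q z" using le[of z] linear_neg[OF lin, of z] by simp
  then show thesis using that lin le by blast
qed

text \<open>Functionals attaining \<open>q\<close> at \<open>z\<close> and at \<open>- z\<close>
  have values of opposite sign at \<open>z\<close>, so a convex combination of them vanishes
  there.\<close>

lemma linear_below_sublinear_vanishing:
  assumes q: "sublinear q" and z: "q z \<ge> 0" "q (- z) \<ge> 0"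
  obtains f where "linear f" "\<And>v. f v \<le> q v" "f z = 0"
proof -
  obtain f where f: "linear f" "\<And>v. f v \<le> q v" "f z = q z"
    using linear_below_sublinear_attaining[OF q, of z] by blast
  obtain h where h: "linear h" "\<And>v. h v \<le> q v" "h (- z) = q (- z)"
    using linear_below_sublinear_attaining[OF q, of "- z"] by blast
  have hz: "h z \<le> 0" using h(3) z(2) linear_neg[OF h(1), of z] by simp
  show thesis
  proof (cases "f z = 0")
    case True
    then show thesis using that f by blast
  next
    case False
    then have d: "f z - h z > 0" using f(3) z(1) hz by simp
    define c where "c = f z / (f z - h z)"
    have c: "0 \<le> c" "c \<le> 1" using d hz f(3) z(1) by (auto simp: c_def field_simps)
    show thesis
    proof (rule that)
      show "linear (\<lambda>v. (1 - c) * f v + c * h v)"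
        using f(1) h(1) by (intro linearI) (simp_all add: linear_add linear_cmul algebra_simps)
      show "(1 - c) * f v + c * h v \<le> q v" for v
        using convex_bound_le[OF f(2)[of v] h(2)[of v], of "1 - c" c] c by simp
      have "f z = c * (f z - h z)" using d by (simp add: c_def)
      then show "(1 - c) * f z + c * h z = 0" by (simp add: algebra_simps)
    qed
  qed
qed

text \<open>\<^term>\<open>sub_shift norm x\<close> is the one-sided derivative of the norm at \<open>x\<close>; a linear functional
  below it is contractive and norms \<open>x\<close>, and orthogonality says that it is nonnegative at \<open>\<plusminus>z\<close>.\<close>

lemma birkhoff_james_functional:
  fixes x z :: "'a::real_normed_vector"
  assumes orth: "x \<bottom>\<^sub>B\<^sub>J z"
  shows "\<exists>f::'a \<Rightarrow>\<^sub>L real. norm f \<le> 1 \<and> blinfun_apply f x = norm x \<and> blinfun_apply f z = 0"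
proof -
  have n: "sublinear (norm :: 'a \<Rightarrow> real)" by (auto simp: sublinear_def norm_triangle_ineq)
  \<comment> \<open>The parameter \<open>s\<close> treats \<open>z\<close> and \<open>- z\<close> at
    once; for \<open>t > 0\<close> this is orthogonality with multiplier \<open>s / t\<close>,
    scaled by \<open>t\<close>.\<close>
  have nonneg: "0 \<le> sub_shift norm x (s *\<^sub>R z)" for s
    unfolding sub_shift_def
  proof (rule cINF_greatest)
    fix t :: real assume "t \<in> {0..}"
    show "0 \<le> norm (s *\<^sub>R z + t *\<^sub>R x) - t * norm x"
    proof (cases "t = 0")
      case False
      then have t: "t > 0" using \<open>t \<in> {0..}\<close> by simp
      have "t * norm x \<le> t * norm (x + (s / t) *\<^sub>R z)"
        using orth t by (simp add: birkhoff_james_def)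
      also have "\<dots> = norm (t *\<^sub>R (x + (s / t) *\<^sub>R z))" using t by simp
      also have "t *\<^sub>R (x + (s / t) *\<^sub>R z) = s *\<^sub>R z + t *\<^sub>R x" using t by (simp add: algebra_simps)
      finally show ?thesis by simp
    qed simp
  qed simp
  obtain f where lin: "linear f" and f: "\<And>v. f v \<le> sub_shift norm x v" and fz: "f z = 0"
    using linear_below_sublinear_vanishing[OF sub_shift(1)[OF n, of x], of z] nonneg[of 1] nonneg[of "-1"]
    by auto
  have le: "f v \<le> norm v" for v using f[of v] sub_shift(2)[OF n, of x v] by simp
  have abs: "\<bar>f v\<bar> \<le> norm v" for v using le[of v] le[of "- v"] linear_neg[OF lin, of v] by auto
  have "f (- x) \<le> - norm x" using f[of "- x"] sub_shift(3)[OF n, of 1 x "- x"] by simp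
  then have fx: "f x = norm x" using le[of x] linear_neg[OF lin, of x] by simp
  have bl: "bounded_linear f"
    by (rule bounded_linear_intro[where K = 1]) (use lin abs in \<open>auto simp: linear_add linear_cmul\<close>)
  have "norm (Blinfun f) \<le> 1"
    by (rule norm_blinfun_bound) (use abs in \<open>auto simp: bounded_linear_Blinfun_apply[OF bl]\<close>)
  then show ?thesis using fx fz
    by (intro exI[of _ "Blinfun f"]) (simp add: bounded_linear_Blinfun_apply[OF bl])
qed

lemma abs_blinfun_apply_le_norm:
  fixes f :: "'a::real_normed_vector \<Rightarrow>\<^sub>L real"
  assumes "norm f \<le> 1"
  shows "\<bar>blinfun_apply f x\<bar> \<le> norm x"
  using order_trans[OF norm_blinfun[of f x] mult_right_mono[OF assms norm_ge_zero[of x]]] by simp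

lemma abs_tensor_pairing_le_norm:
  assumes "norm f \<le> 1" "norm g \<le> 1"
  shows "\<bar>tensor_pairing f g u\<bar> \<le> norm u"
  unfolding norm_tensor_def by (rule injective_norm_upper[OF assms])

lemma norm_tensor_least:
  assumes "\<And>f g. norm f \<le> 1 \<Longrightarrow> norm g \<le> 1 \<Longrightarrow> \<bar>tensor_pairing f g u\<bar> \<le> K"
  shows "norm u \<le> K"
  unfolding norm_tensor_def by (rule injective_norm_least[OF assms])

lemma norm_elem_tensor:
  fixes x :: "'a::real_normed_vector" and y :: "'b::real_normed_vector"
  shows "norm (x \<otimes> y) = norm x * norm y"
proof (rule antisym)
  show "norm (x \<otimes> y) \<le> norm x * norm y"
    by (rule norm_tensor_least) (simp add: abs_mult mult_mono abs_blinfun_apply_le_norm)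
  obtain f :: "'a \<Rightarrow>\<^sub>L real" and g :: "'b \<Rightarrow>\<^sub>L real"
    where "norm f \<le> 1" "blinfun_apply f x = norm x" "norm g \<le> 1" "blinfun_apply g y = norm y"
    using norming_functional[of x] norming_functional[of y] by blast
  then show "norm x * norm y \<le> norm (x \<otimes> y)"
    using abs_tensor_pairing_le_norm[of f g "x \<otimes> y"] by simp
qed

lemma elem_tensor_birkhoff_jamesI:
  fixes x\<^sub>1 x\<^sub>2 :: "'a::real_normed_vector" and y\<^sub>1 y\<^sub>2 :: "'b::real_normed_vector"
  assumes "x\<^sub>1 \<bottom>\<^sub>B\<^sub>J x\<^sub>2 \<or> y\<^sub>1 \<bottom>\<^sub>B\<^sub>J y\<^sub>2"
  shows "x\<^sub>1 \<otimes> y\<^sub>1 \<bottom>\<^sub>B\<^sub>J x\<^sub>2 \<otimes> y\<^sub>2"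
proof -
  \<comment> \<open>Only the product at the second vectors has to vanish, which covers both cases of
    the disjunction.\<close>
  obtain f :: "'a \<Rightarrow>\<^sub>L real" and g :: "'b \<Rightarrow>\<^sub>L real"
    where fg: "norm f \<le> 1" "norm g \<le> 1" "blinfun_apply f x\<^sub>1 = norm x\<^sub>1" "blinfun_apply g y\<^sub>1 = norm y\<^sub>1"
      "blinfun_apply f x\<^sub>2 * blinfun_apply g y\<^sub>2 = 0"
    using assms birkhoff_james_functional norming_functional mult_eq_0_iff by metis
  show ?thesis
    unfolding birkhoff_james_def
  proof
    fix \<mu> :: real
    have "tensor_pairing f g (x\<^sub>1 \<otimes> y\<^sub>1 + \<mu> *\<^sub>R (x\<^sub>2 \<otimes> y\<^sub>2)) = norm (x\<^sub>1 \<otimes> y\<^sub>1)"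
      using fg by (simp add: linear_add[OF linear_tensor_pairing] linear_cmul[OF linear_tensor_pairing]
          norm_elem_tensor)
    then show "norm (x\<^sub>1 \<otimes> y\<^sub>1) \<le> norm (x\<^sub>1 \<otimes> y\<^sub>1 + \<mu> *\<^sub>R (x\<^sub>2 \<otimes> y\<^sub>2))"
      using abs_tensor_pairing_le_norm[OF fg(1,2), of "x\<^sub>1 \<otimes> y\<^sub>1 + \<mu> *\<^sub>R (x\<^sub>2 \<otimes> y\<^sub>2)"] by simp
  qed
qed

text \<open>Doubling the left side gives the CHSH-type expression
  \<open>a * (b + q) + p * (b - q)\<close>.\<close>

lemma abs_mult_diff_half_le:
  fixes a b p q A B P Q :: real
  assumes "\<bar>a\<bar> \<le> A" "\<bar>b\<bar> \<le> B" "\<bar>p\<bar> \<le> P" "\<bar>q\<bar> \<le> Q" "P \<le> A" "Q \<le> B"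
  shows "\<bar>a * b - (a - p) * (b - q) / 2\<bar> \<le> A * B - (A - P) * (B - Q) / 2"
proof -
  have "2 * (a * b - (a - p) * (b - q) / 2) = a * (b + q) + p * (b - q)" by (simp add: field_simps)
  then have "2 * \<bar>a * b - (a - p) * (b - q) / 2\<bar> = \<bar>a * (b + q) + p * (b - q)\<bar>"
    by (metis abs_mult abs_numeral)
  also have "\<dots> \<le> A * \<bar>b + q\<bar> + P * \<bar>b - q\<bar>"
    using abs_triangle_ineq[of "a * (b + q)" "p * (b - q)"]
      mult_right_mono[OF assms(1), of "\<bar>b + q\<bar>"] mult_right_mono[OF assms(3), of "\<bar>b - q\<bar>"]
    by (simp add: abs_mult)
  \<comment> \<open>Regrouped because \<open>\<bar>b + q\<bar> + \<bar>b - q\<bar>\<close> is twice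
    the larger of \<open>\<bar>b\<bar>\<close> and \<open>\<bar>q\<bar>\<close>, hence at most
    \<open>2 * B\<close>; bounding both terms separately would lose too much.\<close>
  also have "\<dots> = (A - P) * \<bar>b + q\<bar> + P * (\<bar>b + q\<bar> + \<bar>b - q\<bar>)" by (simp add: algebra_simps)
  also have "\<dots> \<le> (A - P) * (B + Q) + P * (2 * B)"
    by (intro add_mono mult_left_mono) (use assms in linarith)+
  also have "\<dots> = 2 * (A * B - (A - P) * (B - Q) / 2)" by (simp add: field_simps)
  finally show ?thesis by simp
qed

text \<open>The scalar estimate applies to the values of \<open>f\<close> and \<open>g\<close>, with
  a bound independent of both functionals.\<close>

lemma norm_elem_tensor_diff_half_le:
  fixes x p :: "'a::real_normed_vector" and y q :: "'b::real_normed_vector"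
  assumes "norm p \<le> norm x" "norm q \<le> norm y"
  shows "norm (x \<otimes> y - (1 / 2) *\<^sub>R ((x - p) \<otimes> (y - q)))
    \<le> norm x * norm y - (norm x - norm p) * (norm y - norm q) / 2"
proof (rule norm_tensor_least)
  fix f :: "'a \<Rightarrow>\<^sub>L real" and g :: "'b \<Rightarrow>\<^sub>L real" assume fg: "norm f \<le> 1" "norm g \<le> 1"
  show "\<bar>tensor_pairing f g (x \<otimes> y - (1 / 2) *\<^sub>R ((x - p) \<otimes> (y - q)))\<bar>
    \<le> norm x * norm y - (norm x - norm p) * (norm y - norm q) / 2"
    using abs_mult_diff_half_le[OF abs_blinfun_apply_le_norm[OF fg(1), of x]
        abs_blinfun_apply_le_norm[OF fg(2), of y] abs_blinfun_apply_le_norm[OF fg(1), of p]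
        abs_blinfun_apply_le_norm[OF fg(2), of q] assms]
    by (simp add: linear_diff[OF linear_tensor_pairing] linear_cmul[OF linear_tensor_pairing]
        blinfun.diff_right)
qed

lemma elem_tensor_birkhoff_jamesD:
  fixes x\<^sub>1 x\<^sub>2 :: "'a::real_normed_vector" and y\<^sub>1 y\<^sub>2 :: "'b::real_normed_vector"
  assumes orth: "x\<^sub>1 \<otimes> y\<^sub>1 \<bottom>\<^sub>B\<^sub>J x\<^sub>2 \<otimes> y\<^sub>2"
  shows "x\<^sub>1 \<bottom>\<^sub>B\<^sub>J x\<^sub>2 \<or> y\<^sub>1 \<bottom>\<^sub>B\<^sub>J y\<^sub>2"
proof (rule ccontr)
  assume "\<not> ?thesis"
  then obtain \<mu> \<nu> where \<mu>: "norm (x\<^sub>1 + \<mu> *\<^sub>R x\<^sub>2) < norm x\<^sub>1" and \<nu>: "norm (y\<^sub>1 + \<nu> *\<^sub>R y\<^sub>2) < norm y\<^sub>1"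
    by (auto simp: birkhoff_james_def not_le)
  define p where "p = x\<^sub>1 + \<mu> *\<^sub>R x\<^sub>2"
  define q where "q = y\<^sub>1 + \<nu> *\<^sub>R y\<^sub>2"
  have "x\<^sub>1 - p = (- \<mu>) *\<^sub>R x\<^sub>2" "y\<^sub>1 - q = (- \<nu>) *\<^sub>R y\<^sub>2" by (simp_all add: p_def q_def)
  then have "(x\<^sub>1 - p) \<otimes> (y\<^sub>1 - q) = (\<mu> * \<nu>) *\<^sub>R (x\<^sub>2 \<otimes> y\<^sub>2)"
    by (simp only: elem_tensor_bilinear scaleR_scaleR) (simp add: mult.commute)
  then have "x\<^sub>1 \<otimes> y\<^sub>1 + (- (\<mu> * \<nu> / 2)) *\<^sub>R (x\<^sub>2 \<otimes> y\<^sub>2) = x\<^sub>1 \<otimes> y\<^sub>1 - (1 / 2) *\<^sub>R ((x\<^sub>1 - p) \<otimes> (y\<^sub>1 - q))"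
    by simp
  then have "norm (x\<^sub>1 \<otimes> y\<^sub>1) \<le> norm (x\<^sub>1 \<otimes> y\<^sub>1 - (1 / 2) *\<^sub>R ((x\<^sub>1 - p) \<otimes> (y\<^sub>1 - q)))"
    using orth unfolding birkhoff_james_def by metis
  also have "\<dots> \<le> norm x\<^sub>1 * norm y\<^sub>1 - (norm x\<^sub>1 - norm p) * (norm y\<^sub>1 - norm q) / 2"
    by (rule norm_elem_tensor_diff_half_le) (use \<mu> \<nu> in \<open>auto simp: p_def q_def\<close>)
  also have "\<dots> < norm x\<^sub>1 * norm y\<^sub>1" using \<mu> \<nu> by (simp add: p_def q_def)
  finally show False by (simp add: norm_elem_tensor)
qed

text \<open>Orthogonality involves only norms of linear combinations of the two vectors, and these
  survive a linear isometry.\<close>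

lemma birkhoff_james_to_completion: "to_completion u \<bottom>\<^sub>B\<^sub>J to_completion v \<longleftrightarrow> u \<bottom>\<^sub>B\<^sub>J v"
proof -
  have "norm (to_completion u + \<mu> *\<^sub>R to_completion v) = norm (u + \<mu> *\<^sub>R v)" for \<mu>
    by (metis linear_add linear_cmul linear_to_completion norm_to_completion)
  then show ?thesis by (simp add: birkhoff_james_def)
qed

theorem theorem3p7:
  fixes x\<^sub>1 x\<^sub>2 :: "'a::banach" and y\<^sub>1 y\<^sub>2 :: "'b::banach"
  shows "(to_completion (x\<^sub>1 \<otimes> y\<^sub>1) :: ('a, 'b) injective_tensor_product) \<bottom>\<^sub>B\<^sub>J to_completion (x\<^sub>2 \<otimes> y\<^sub>2)
     \<longleftrightarrow> x\<^sub>1 \<bottom>\<^sub>B\<^sub>J x\<^sub>2 \<or> y\<^sub>1 \<bottom>\<^sub>B\<^sub>J y\<^sub>2"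
  unfolding birkhoff_james_to_completion
  using elem_tensor_birkhoff_jamesI elem_tensor_birkhoff_jamesD by blast

end
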